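(* Fix the finite state space, the finite action spaces and the transition probabilities. Then the space $\mathcal{R}$ of transition payments is covered by a polyhedral fan such that for each transition payment $r$ in the interior of a full-dimensional cone of this fan, the following holds: if the Hoffman–Karp policy iteration algorithm applied to $T_r$ is well posed, that is, if at each step $k$ of the algorithm the operator $T_r^{\sigma_k}$ has an eigenvalue, then the algorithm terminates after a finite number of steps and gives an eigenvalue $\lambda$ and a bias vector $u$ of $T_r$.
   Context: Data: $S=\{1,\dots,n\}$ is a finite state space; for each $i\in S$, $A_i$ is a nonempty finite set (actions of player MIN); for each $i\in S$, $a\in A_i$, $B_{i,a}$ is a nonempty finite set (actions of player MAX); for each $i\in S$, $a\in A_i$, $b\in B_{i,a}$, $P_i^{ab}$ is a probability over $S$, seen as a row vector, so that $P_i^{ab}x=\sum_{j=1}^n (P_i^{ab})_jx_j$ for $x\in\mathbb{R}^n$. The space of transition payments $\mathcal{R}$ is the set of all real families $r=(r_i^{ab})$ indexed by the triples $(i,a,b)$ with $i\in S$, $a\in A_i$, $b\in B_{i,a}$; it is identified with $\mathbb{R}^q$, where $q$ is the number of such triples. For $r\in\mathcal{R}$, the Shapley operator $T_r:\mathbb{R}^n\to\mathbb{R}^n$ is $$[T_r(x)]_i=\min_{a\in A_i}\max_{b\in B_{i,a}}\big(r_i^{ab}+P_i^{ab}x\big),\qquad i\in S.$$ Let $\Sigma$ be the finite set of policies of player MIN, i.e. of maps $\sigma$ assigning to each $i\in S$ an element $\sigma(i)\in A_i$. For $\sigma\in\Sigma$, define $T_r^\sigma:\mathbb{R}^n\to\mathbb{R}^n$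 by $$[T_r^\sigma(x)]_i=\max_{b\in B_{i,\sigma(i)}}\big(r_i^{\sigma(i)b}+P_i^{\sigma(i)b}x\big),\qquad i\in S.$$ Let $\mathbf{1}=(1,\dots,1)\in\mathbb{R}^n$. A map $T:\mathbb{R}^n\to\mathbb{R}^n$ has an eigenvalue $\lambda\in\mathbb{R}$ if there is $u\in\mathbb{R}^n$ such that $T(u)=\lambda\mathbf{1}+u$; such a vector $u$ is called a bias vector (or eigenvector) of $T$. (For the operators above the eigenvalue, if it exists, is unique.) Hoffman–Karp policy iteration algorithm applied to $T=T_r$ (with $T^\sigma=T_r^\sigma$): select an arbitrary policy $\sigma_0\in\Sigma$; then for $k\ge 0$ apply successively the two following steps, until $\sigma_{k+1}=\sigma_k$: (i) compute the eigenvalue $\lambda^k$ and a bias vector $v^k$ of $T^{\sigma_k}$, i.e. a solution $(\lambda,v)=(\lambda^k,v^k)$ of $\lambda\mathbf{1}+v=T^{\sigma_k}(v)$; (ii) choose $\sigma_{k+1}\in\Sigma$ such that $T(v^k)=T^{\sigma_{k+1}}(v^k)$, with $\sigma_{k+1}=\sigma_k$ as soon as this is possible. Return $\lambda^k$ and $v^k$. A polyhedral fan in $\mathbb{R}^q$ is a finite set $\mathcal{K}$ of polyhedral cones such that every face of an element of $\mathcal{K}$ belongs to $\mathcal{K}$, and for all $P,Q\in\mathcal{K}$, $P\cap Q$ is a face of both $P$ and $Q$. It covers $\mathbb{R}^q$ if the union of its cones is $\mathbb{R}^q$. *)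

theory Defs
  imports "HOL-Analysis.Analysis"
begin

subsection \<open>Polyhedral fans\<close>

text \<open>
  In the library both \<^const>\<open>polyhedron\<close> and \<^const>\<open>cone\<close> hold of the empty set, and the empty set
  is a face of every convex set. A polyhedral cone contains the origin, so the empty set is
  excluded here, both as a cone and as a face.
\<close>

definition polyhedral_cone :: "'v::euclidean_space set \<Rightarrow> bool" where
  "polyhedral_cone C \<longleftrightarrow> polyhedron C \<and> cone C \<and> C \<noteq> {}"

definition polyhedral_fan :: "'v::euclidean_space set set \<Rightarrow> bool" where
  "polyhedral_fan K \<longleftrightarrow>
     finite K \<and>
     (\<forall>C\<in>K. polyhedral_cone C) \<and>
     (\<forall>C\<in>K. \<forall>F. F face_of C \<and> F \<noteq> {} \<longrightarrow> F \<in> K) \<and>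
     (\<forall>C\<in>K. \<forall>D\<in>K. (C \<inter> D) face_of C \<and> (C \<inter> D) face_of D)"

subsection \<open>Shapley operators\<close>

text \<open>
  The states are the elements of the finite type \<open>'s\<close>; \<open>A i\<close> and \<open>B i a\<close> are the action sets of
  players MIN and MAX. A payment is indexed by the triples below. The space of payments is
  identified with \<open>real^'q\<close> by a bijection \<open>e\<close> from the index type \<open>'q\<close> onto the set of
  triples, so that the payment for \<open>(i, a, b)\<close> is the coordinate \<open>inv e (i, a, b)\<close>.
\<close>

definition triples :: "('s \<Rightarrow> 'a set) \<Rightarrow> ('s \<Rightarrow> 'a \<Rightarrow> 'b set) \<Rightarrow> ('s \<times> 'a \<times> 'b) set" where
  "triples A B = (SIGMA i:UNIV. SIGMA a:A i. B i a)"

definition payment :: "('q::finite \<Rightarrow> 's \<times> 'a \<times> 'b) \<Rightarrow> real^'q \<Rightarrow> 's \<Rightarrow> 'a \<Rightarrow> 'b \<Rightarrow> real" where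
  "payment e r i a b = r $ inv e (i, a, b)"

definition shapley ::
    "('s::finite \<Rightarrow> 'a set) \<Rightarrow> ('s \<Rightarrow> 'a \<Rightarrow> 'b set) \<Rightarrow> ('s \<Rightarrow> 'a \<Rightarrow> 'b \<Rightarrow> real^'s) \<Rightarrow>
     ('q::finite \<Rightarrow> 's \<times> 'a \<times> 'b) \<Rightarrow> real^'q \<Rightarrow> real^'s \<Rightarrow> real^'s" where
  "shapley A B P e r x =
     (\<chi> i. MIN a\<in>A i. MAX b\<in>B i a. payment e r i a b + P i a b \<bullet> x)"

definition policies :: "('s \<Rightarrow> 'a set) \<Rightarrow> ('s \<Rightarrow> 'a) set" where
  "policies A = {\<sigma>. \<forall>i. \<sigma> i \<in> A i}"

definition shapley_policy ::
    "('s::finite \<Rightarrow> 'a \<Rightarrow> 'b set) \<Rightarrow> ('s \<Rightarrow> 'a \<Rightarrow> 'b \<Rightarrow> real^'s) \<Rightarrow>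
     ('q::finite \<Rightarrow> 's \<times> 'a \<times> 'b) \<Rightarrow> real^'q \<Rightarrow> ('s \<Rightarrow> 'a) \<Rightarrow> real^'s \<Rightarrow> real^'s" where
  "shapley_policy B P e r \<sigma> x =
     (\<chi> i. MAX b\<in>B i (\<sigma> i). payment e r i (\<sigma> i) b + P i (\<sigma> i) b \<bullet> x)"

definition eigenpair :: "(real^'s \<Rightarrow> real^'s) \<Rightarrow> real \<Rightarrow> real^'s::finite \<Rightarrow> bool" where
  "eigenpair T lam u \<longleftrightarrow> T u = lam *\<^sub>R 1 + u"

definition has_eigenvalue :: "(real^'s \<Rightarrow> real^'s::finite) \<Rightarrow> bool" where
  "has_eigenvalue T \<longleftrightarrow> (\<exists>lam u. eigenpair T lam u)"

subsection \<open>Hoffman--Karp policy iteration\<close>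

text \<open>
  One iteration: from the policy \<open>\<sigma>\<close>, compute \<open>(lam, v)\<close>, then choose the next policy \<open>\<sigma>'\<close>.
\<close>

definition hoffman_karp_step ::
    "'p set \<Rightarrow> (real^'s \<Rightarrow> real^'s) \<Rightarrow> ('p \<Rightarrow> real^'s \<Rightarrow> real^'s::finite) \<Rightarrow>
     'p \<Rightarrow> real \<Rightarrow> real^'s \<Rightarrow> 'p \<Rightarrow> bool" where
  "hoffman_karp_step \<Sigma> T Tp \<sigma> lam v \<sigma>' \<longleftrightarrow>
     eigenpair (Tp \<sigma>) lam v \<and>
     \<sigma>' \<in> \<Sigma> \<and> T v = Tp \<sigma>' v \<and> (T v = Tp \<sigma> v \<longrightarrow> \<sigma>' = \<sigma>)"

text \<open>
  A maximal execution performing \<open>N\<close> iterations (possibly infinitely many), with arbitrary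
  choices of initial policy, bias vectors and improved policies. Only \<open>\<sigma> k\<close> for \<open>k \<le> N\<close> and
  \<open>lam k\<close>, \<open>v k\<close> for \<open>k < N\<close> are meaningful. A finite execution ends either by the stopping test
  or because the current policy operator has no eigenvalue; the latter is the only way to get
  stuck, and is what well-posedness rules out.
\<close>

definition hoffman_karp_stops :: "enat \<Rightarrow> (nat \<Rightarrow> 'p) \<Rightarrow> nat \<Rightarrow> bool" where
  "hoffman_karp_stops N \<sigma> k \<longleftrightarrow> N = enat (Suc k) \<and> \<sigma> (Suc k) = \<sigma> k"

definition hoffman_karp_execution ::
    "'p set \<Rightarrow> (real^'s \<Rightarrow> real^'s) \<Rightarrow> ('p \<Rightarrow> real^'s \<Rightarrow> real^'s::finite) \<Rightarrow>
     enat \<Rightarrow> (nat \<Rightarrow> 'p) \<Rightarrow> (nat \<Rightarrow> real) \<Rightarrow> (nat \<Rightarrow> real^'s) \<Rightarrow> bool" where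
  "hoffman_karp_execution \<Sigma> T Tp N \<sigma> lam v \<longleftrightarrow>
     \<sigma> 0 \<in> \<Sigma> \<and>
     (\<forall>k. enat k < N \<longrightarrow> hoffman_karp_step \<Sigma> T Tp (\<sigma> k) (lam k) (v k) (\<sigma> (Suc k))) \<and>
     (\<forall>k. enat (Suc k) < N \<longrightarrow> \<sigma> (Suc k) \<noteq> \<sigma> k) \<and>
     (\<forall>m. N = enat m \<longrightarrow>
        (\<exists>k. hoffman_karp_stops N \<sigma> k) \<or> \<not> has_eigenvalue (Tp (\<sigma> m)))"

definition hoffman_karp_well_posed ::
    "('p \<Rightarrow> real^'s \<Rightarrow> real^'s::finite) \<Rightarrow> enat \<Rightarrow> (nat \<Rightarrow> 'p) \<Rightarrow> bool" where
  "hoffman_karp_well_posed Tp N \<sigma> \<longleftrightarrow> (\<forall>k. enat k \<le> N \<longrightarrow> has_eigenvalue (Tp (\<sigma> k)))"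

end

theory Submission
  imports Defs
begin

text \<open>
  The fan is the one cut out by the hyperplanes orthogonal to the differences of finitely many
  occupation measures: one stationary distribution, viewed as a measure on triples, for every pair
  of stationary policies and every set of states closed under the corresponding chain. In the
  interior of a maximal cone distinct occupation measures earn distinct mean payoffs.

  Along the algorithm the eigenvalues do not increase. If the policy at step \<open>m\<close> equals that at
  step \<open>k < m\<close>, then the eigenvalue is constant in between, so by genericity a single occupation
  measure attains it. The set where \<open>v\<^sup>j - v\<^sup>j\<^sup>+\<^sup>1\<close> is minimal is closed under a chain optimal
  at \<open>v\<^sup>j\<^sup>+\<^sup>1\<close>, hence carries an occupation measure attaining the eigenvalue, which must be the same
  one for all \<open>j\<close>. So, for a fixed state \<open>i\<close> in its support, the vectors \<open>v\<^sup>j\<close> normalised to vanish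
  at \<open>i\<close> decrease with \<open>j\<close>; since the normalised vectors at \<open>k\<close> and \<open>m\<close> are equal, they are constant,
  and the algorithm should have stopped at step \<open>k\<close>.
\<close>

subsection \<open>Fans of hyperplane arrangements\<close>

text \<open>The closed cell with \<open>x\<close> in its relative interior, for the hyperplanes
  through the origin with normals in \<open>Z\<close>. Letting \<open>x\<close> vary yields cells of
  every dimension.\<close>

definition arrangement_cell :: "'v::euclidean_space set \<Rightarrow> 'v \<Rightarrow> 'v set" where
  "arrangement_cell Z x = {r. \<forall>z\<in>Z. sgn (z \<bullet> r) = 0 \<or> sgn (z \<bullet> r) = sgn (z \<bullet> x)}"

lemma arrangement_cell_eq_Inter:
  "arrangement_cell Z x =
     (\<Inter>z\<in>Z. if z \<bullet> x = 0 then {r. z \<bullet> r = 0} else if z \<bullet> x > 0 then {r. z \<bullet> r \<ge> 0} else {r. z \<bullet> r \<le> 0})"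
proof -
  have "{r. sgn (z \<bullet> r) = 0 \<or> sgn (z \<bullet> r) = sgn (z \<bullet> x)} =
      (if z \<bullet> x = 0 then {r. z \<bullet> r = 0} else if z \<bullet> x > 0 then {r. z \<bullet> r \<ge> 0} else {r. z \<bullet> r \<le> 0})"
    for z
    by (auto simp: sgn_if)
  moreover have "arrangement_cell Z x = (\<Inter>z\<in>Z. {r. sgn (z \<bullet> r) = 0 \<or> sgn (z \<bullet> r) = sgn (z \<bullet> x)})"
    by (auto simp: arrangement_cell_def)
  ultimately show ?thesis by simp
qed

lemma mem_arrangement_cell: "x \<in> arrangement_cell Z x"
  by (simp add: arrangement_cell_def)

lemma polyhedral_cone_arrangement_cell:
  assumes "finite Z"
  shows "polyhedral_cone (arrangement_cell Z x)"
proof -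
  have "polyhedron (arrangement_cell Z x)"
    unfolding arrangement_cell_eq_Inter using assms
    by (intro polyhedron_Inter)
      (auto simp: polyhedron_hyperplane polyhedron_halfspace_ge polyhedron_halfspace_le)
  moreover have "cone (arrangement_cell Z x)"
    unfolding cone_def
  proof (intro ballI allI impI)
    fix r :: 'a and c :: real
    assume "r \<in> arrangement_cell Z x" "c \<ge> 0"
    then show "c *\<^sub>R r \<in> arrangement_cell Z x"
      by (cases "c = 0") (simp_all add: arrangement_cell_def sgn_mult)
  qed
  ultimately show ?thesis
    using mem_arrangement_cell by (auto simp: polyhedral_cone_def)
qed

lemma convex_arrangement_cell:
  "finite Z \<Longrightarrow> convex (arrangement_cell Z x)"
  using polyhedral_cone_arrangement_cell[of Z x] by (simp add: polyhedral_cone_def polyhedron_imp_convex)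

text \<open>Each \<open>z\<close> in \<open>Z\<close> keeps a weak sign on the cell, so its
  hyperplane cuts out a face, and intersections of faces are faces.\<close>

lemma face_of_arrangement_cell:
  assumes "finite Z" "W \<subseteq> Z"
  shows "(arrangement_cell Z x \<inter> {r. \<forall>z\<in>W. z \<bullet> r = 0}) face_of arrangement_cell Z x"
proof -
  let ?C = "arrangement_cell Z x"
  have cvx: "convex ?C"
    using assms by (simp add: convex_arrangement_cell)
  have "(?C \<inter> {r. z \<bullet> r = 0}) face_of ?C" if "z \<in> Z" for z
  proof (cases "z \<bullet> x \<ge> 0")
    case True
    then have "z \<bullet> r \<ge> 0" if "r \<in> ?C" for r
      using that \<open>z \<in> Z\<close> by (force simp: arrangement_cell_def sgn_if split: if_splits)
    then show ?thesis
      by (intro face_of_Int_supporting_hyperplane_ge cvx)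
  next
    case False
    then have "z \<bullet> r \<le> 0" if "r \<in> ?C" for r
      using that \<open>z \<in> Z\<close> by (force simp: arrangement_cell_def sgn_if split: if_splits)
    then show ?thesis
      by (intro face_of_Int_supporting_hyperplane_le cvx)
  qed
  then have "\<Inter>(insert ?C ((\<lambda>z. ?C \<inter> {r. z \<bullet> r = 0}) ` W)) face_of ?C"
    using assms(2) by (intro face_of_Inter) (auto simp: face_of_refl cvx)
  moreover have "\<Inter>(insert ?C ((\<lambda>z. ?C \<inter> {r. z \<bullet> r = 0}) ` W)) = ?C \<inter> {r. \<forall>z\<in>W. z \<bullet> r = 0}"
    by auto
  ultimately show ?thesis by simp
qed

text \<open>The hyperplanes through \<open>x\<close> contain the affine hull of the cell; the other
  sign conditions are strict at \<open>x\<close>, hence hold on a neighbourhood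
  \<open>U\<close>.\<close>

lemma mem_rel_interior_arrangement_cell:
  assumes "finite Z"
  shows "x \<in> rel_interior (arrangement_cell Z x)"
proof -
  let ?C = "arrangement_cell Z x"
  define L where "L = (\<Inter>z\<in>{z\<in>Z. z \<bullet> x = 0}. {r. z \<bullet> r = 0})"
  define U where "U = (\<Inter>z\<in>{z\<in>Z. z \<bullet> x \<noteq> 0}. {r. sgn (z \<bullet> x) * (z \<bullet> r) > 0})"
  have "open U"
    unfolding U_def using assms
    by (intro open_INT ballI open_Collect_less continuous_intros) auto
  moreover have "x \<in> U"
    by (auto simp: U_def sgn_if)
  moreover have "affine hull ?C \<subseteq> L"
  proof (rule hull_minimal)
    show "?C \<subseteq> L"
      unfolding arrangement_cell_eq_Inter L_def by force
    show "affine L"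
      unfolding L_def by (intro affine_Inter) (auto simp: affine_hyperplane)
  qed
  moreover have "U \<inter> L \<subseteq> ?C"
  proof
    fix r assume r: "r \<in> U \<inter> L"
    have "sgn (z \<bullet> r) = sgn (z \<bullet> x)" if "z \<in> Z" for z
      using that r by (cases "z \<bullet> x = 0") (auto simp: U_def L_def sgn_if split: if_splits)
    then show "r \<in> ?C" by (simp add: arrangement_cell_def)
  qed
  ultimately show ?thesis
    using mem_arrangement_cell mem_rel_interior by blast
qed

lemma polyhedral_fan_arrangement:
  assumes "finite Z"
  shows "polyhedral_fan (range (arrangement_cell Z))"
  unfolding polyhedral_fan_def
proof (intro conjI ballI allI impI)
  \<comment> \<open>A cell depends only on the sign vector of \<open>x\<close>, which takes finitely
    many values.\<close>
  have "range (arrangement_cell Z) \<subseteq>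
      (\<lambda>s. {r. \<forall>z\<in>Z. sgn (z \<bullet> r) = 0 \<or> sgn (z \<bullet> r) = s z}) ` (Z \<rightarrow>\<^sub>E {-1, 0, 1})"
  proof
    fix C assume "C \<in> range (arrangement_cell Z)"
    then obtain x where "C = arrangement_cell Z x" by auto
    then have "C = {r. \<forall>z\<in>Z. sgn (z \<bullet> r) = 0 \<or> sgn (z \<bullet> r) = restrict (\<lambda>z. sgn (z \<bullet> x)) Z z}"
      by (simp add: arrangement_cell_def)
    moreover have "restrict (\<lambda>z. sgn (z \<bullet> x)) Z \<in> Z \<rightarrow>\<^sub>E {-1, 0, 1}"
      by (auto simp: sgn_if)
    ultimately show "C \<in> (\<lambda>s. {r. \<forall>z\<in>Z. sgn (z \<bullet> r) = 0 \<or> sgn (z \<bullet> r) = s z}) ` (Z \<rightarrow>\<^sub>E {-1, 0, 1})"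
      by (rule image_eqI)
  qed
  then show "finite (range (arrangement_cell Z))"
    by (rule finite_subset) (intro finite_imageI finite_PiE assms, simp)
next
  fix C assume "C \<in> range (arrangement_cell Z)"
  then show "polyhedral_cone C"
    using polyhedral_cone_arrangement_cell assms by auto
next
  fix C F assume "C \<in> range (arrangement_cell Z)" and F: "F face_of C \<and> F \<noteq> {}"
  then obtain x where C: "C = arrangement_cell Z x" by auto
  have "convex F"
    using F face_of_imp_convex by blast
  \<comment> \<open>Faces of \<open>C\<close> whose relative interiors meet are equal, so it
    suffices that the cell of \<open>y\<close> is a face of \<open>C\<close>.\<close>
  then obtain y where y: "y \<in> rel_interior F"
    using F rel_interior_eq_empty by blast
  then have "y \<in> C"
    using F face_of_imp_subset rel_interior_subset by blast
  then have "arrangement_cell Z y = C \<inter> {r. \<forall>z\<in>{z\<in>Z. z \<bullet> y = 0}. z \<bullet> r = 0}"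
    unfolding C arrangement_cell_def by (fastforce simp: sgn_0_0)
  then have "arrangement_cell Z y face_of C"
    unfolding C using face_of_arrangement_cell[OF assms, of "{z\<in>Z. z \<bullet> y = 0}" x] by auto
  then have "F = arrangement_cell Z y"
    using face_of_eq F y mem_rel_interior_arrangement_cell[OF assms, of y] by blast
  then show "F \<in> range (arrangement_cell Z)" by blast
next
  fix C D assume "C \<in> range (arrangement_cell Z)" "D \<in> range (arrangement_cell Z)"
  then obtain x y where CD: "C = arrangement_cell Z x" "D = arrangement_cell Z y" by auto
  \<comment> \<open>Where the signs of \<open>x\<close> and \<open>y\<close> differ, a common point
    must have sign 0; elsewhere both cells impose the same condition.\<close>
  define W where "W = {z\<in>Z. sgn (z \<bullet> x) \<noteq> sgn (z \<bullet> y)}"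
  have W: "W \<subseteq> Z" by (auto simp: W_def)
  have "C \<inter> D = C \<inter> {r. \<forall>z\<in>W. z \<bullet> r = 0}"
    unfolding CD arrangement_cell_def W_def by (fastforce simp: sgn_0_0)
  then show "(C \<inter> D) face_of C"
    using face_of_arrangement_cell[OF assms W] CD by simp
  have "C \<inter> D = D \<inter> {r. \<forall>z\<in>W. z \<bullet> r = 0}"
    unfolding CD arrangement_cell_def W_def by (fastforce simp: sgn_0_0)
  then show "(C \<inter> D) face_of D"
    using face_of_arrangement_cell[OF assms W] CD by simp
qed

text \<open>The cell lies in a hyperplane, whose interior is empty, or in a half-space, whose
  interior is the open half-space. This provides the genericity of payments.\<close>

lemma interior_arrangement_cell_nonzero:
  assumes "r \<in> interior (arrangement_cell Z x)" "z \<in> Z" "z \<noteq> 0"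
  shows "z \<bullet> r \<noteq> 0"
proof -
  let ?H = "if z \<bullet> x = 0 then {r. z \<bullet> r = 0} else if z \<bullet> x > 0 then {r. z \<bullet> r \<ge> 0} else {r. z \<bullet> r \<le> 0}"
  have "arrangement_cell Z x \<subseteq> ?H"
    unfolding arrangement_cell_eq_Inter using assms(2) by blast
  then have "r \<in> interior ?H"
    using assms(1) interior_mono by blast
  then show ?thesis
    using assms(3) by (auto simp: interior_hyperplane interior_halfspace_ge interior_halfspace_le
        split: if_splits)
qed

subsection \<open>Stationary distributions and occupation measures\<close>

text \<open>Brouwer's theorem on the simplex of distributions supported in \<open>D\<close>, which
  the chain maps to itself because \<open>D\<close> is closed.\<close>

lemma stationary_distribution_exists:
  fixes Q :: "'s::finite \<Rightarrow> real^'s"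
  assumes nonneg: "\<And>i j. Q i $ j \<ge> 0" and sum1: "\<And>i. (\<Sum>j\<in>UNIV. Q i $ j) = 1"
    and "D \<noteq> {}" and closed: "\<And>i j. i \<in> D \<Longrightarrow> j \<notin> D \<Longrightarrow> Q i $ j = 0"
  shows "\<exists>p. (\<forall>i. p $ i \<ge> 0) \<and> (\<forall>i. i \<notin> D \<longrightarrow> p $ i = 0) \<and> (\<Sum>i\<in>UNIV. p $ i) = 1 \<and>
    (\<Sum>i\<in>UNIV. p $ i *\<^sub>R Q i) = p"
proof -
  define S where "S = {p::real^'s. (\<forall>i. p $ i \<ge> 0) \<and> (\<forall>i. i \<notin> D \<longrightarrow> p $ i = 0) \<and> (\<Sum>i\<in>UNIV. p $ i) = 1}"
  have S: "S = {p. \<forall>i. p $ i \<ge> 0} \<inter> {p. \<forall>i. i \<notin> D \<longrightarrow> p $ i = 0} \<inter> {p. (\<Sum>i\<in>UNIV. p $ i) = 1}"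
    by (auto simp: S_def)
  have "closed S"
    unfolding S by (intro closed_Int closed_Collect_all closed_Collect_imp closed_Collect_le
        closed_Collect_eq continuous_intros open_Collect_const)
  moreover have "bounded S"
    unfolding bounded_iff
  proof (intro exI ballI)
    fix p assume "p \<in> S"
    then have "norm p \<le> (\<Sum>i\<in>UNIV. \<bar>p $ i\<bar>)" "(\<Sum>i\<in>UNIV. \<bar>p $ i\<bar>) = 1"
      using norm_le_l1_cart[of p] by (auto simp: S_def)
    then show "norm p \<le> 1" by simp
  qed
  ultimately have "compact S"
    using compact_eq_bounded_closed by blast
  moreover have "convex S"
    by (rule convexI) (auto simp: S_def sum.distrib simp flip: sum_distrib_left)
  moreover have "S \<noteq> {}"
  proof -
    obtain i where "i \<in> D" using \<open>D \<noteq> {}\<close> by blast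
    then have "axis i 1 \<in> S" by (auto simp: S_def axis_def)
    then show ?thesis by blast
  qed
  moreover have "continuous_on S (\<lambda>p. \<Sum>i\<in>UNIV. p $ i *\<^sub>R Q i)"
    by (intro continuous_intros)
  moreover have "(\<lambda>p. \<Sum>i\<in>UNIV. p $ i *\<^sub>R Q i) \<in> S \<rightarrow> S"
  proof
    fix p assume p: "p \<in> S"
    have "(\<Sum>i\<in>UNIV. p $ i *\<^sub>R Q i) $ j = 0" if "j \<notin> D" for j
    proof -
      have "p $ i * Q i $ j = 0" for i
        using p closed[of i j] that by (cases "i \<in> D") (auto simp: S_def)
      then have "(\<Sum>i\<in>UNIV. p $ i * Q i $ j) = 0"
        by (intro sum.neutral) blast
      then show ?thesis by simp
    qed
    moreover have "(\<Sum>j\<in>UNIV. \<Sum>i\<in>UNIV. p $ i * Q i $ j) = 1"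
      using p by (subst sum.swap) (simp add: sum1 S_def flip: sum_distrib_left)
    ultimately show "(\<Sum>i\<in>UNIV. p $ i *\<^sub>R Q i) \<in> S"
      using p nonneg by (auto simp: S_def intro!: sum_nonneg)
  qed
  ultimately obtain p where "p \<in> S" "(\<Sum>i\<in>UNIV. p $ i *\<^sub>R Q i) = p"
    by (rule brouwer)
  then show ?thesis by (auto simp: S_def)
qed

text \<open>Minimum principle: \<open>q \<bullet> d - m\<close> is a sum of nonnegative terms, so an
  average equal to \<open>m\<close> puts no mass where \<open>d\<close> exceeds
  \<open>m\<close>.\<close>

lemma superharmonic_argmin_closed:
  fixes q d :: "real^'s::finite"
  assumes "\<And>j. q $ j \<ge> 0" "(\<Sum>j\<in>UNIV. q $ j) = 1" and "\<And>j. m \<le> d $ j"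
  shows "m \<le> q \<bullet> d" and "q \<bullet> d \<le> m \<Longrightarrow> d $ j \<noteq> m \<Longrightarrow> q $ j = 0"
proof -
  have eq: "q \<bullet> d - m = (\<Sum>j\<in>UNIV. q $ j * (d $ j - m))"
    using assms(2) by (simp add: inner_vec_def algebra_simps sum_subtractf flip: sum_distrib_left)
  have nn: "q $ j * (d $ j - m) \<ge> 0" for j
    using assms(1,3) by simp
  then show le: "m \<le> q \<bullet> d"
    using eq sum_nonneg[of UNIV "\<lambda>j. q $ j * (d $ j - m)"] by simp
  assume "q \<bullet> d \<le> m" "d $ j \<noteq> m"
  then have "(\<Sum>j\<in>UNIV. q $ j * (d $ j - m)) = 0"
    using eq le by simp
  then have "q $ j * (d $ j - m) = 0"
    using nn by (subst (asm) sum_nonneg_eq_0_iff) auto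
  then show "q $ j = 0" using \<open>d $ j \<noteq> m\<close> by simp
qed

text \<open>
  An element of \<open>'q\<close> is a decision, taken in state \<open>st q\<close> and with transition probabilities
  \<open>R q\<close>; a map \<open>g :: 's \<Rightarrow> 'q\<close> is a stationary policy of both players together.
\<close>

definition occupation_family ::
    "('q::finite \<Rightarrow> 's) \<Rightarrow> ('q \<Rightarrow> real^'s::finite) \<Rightarrow> (real^'q) set \<Rightarrow> bool" where
  "occupation_family st R X \<longleftrightarrow>
     (\<forall>g D. (\<forall>i. st (g i) = i) \<and> D \<noteq> {} \<and> (\<forall>i\<in>D. \<forall>j. j \<notin> D \<longrightarrow> R (g i) $ j = 0) \<longrightarrow>
       (\<exists>x\<in>X. (\<forall>q. x $ q \<noteq> 0 \<longrightarrow> st q \<in> D) \<and>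
          (\<forall>r lam v. (\<forall>i. r $ g i + R (g i) \<bullet> v = lam + v $ i) \<longrightarrow> x \<bullet> r = lam)))"

text \<open>One vector is taken for each pair \<open>(g, D)\<close>, and there are finitely many
  pairs.\<close>

lemma finite_occupation_family_exists:
  fixes R :: "'q::finite \<Rightarrow> real^'s::finite"
  assumes nonneg: "\<And>q j. R q $ j \<ge> 0" and sum1: "\<And>q. (\<Sum>j\<in>UNIV. R q $ j) = 1"
  shows "\<exists>X. finite X \<and> occupation_family st R X"
proof -
  let ?ok = "\<lambda>g D. (\<forall>i. st (g i) = i) \<and> D \<noteq> {} \<and> (\<forall>i\<in>D. \<forall>j. j \<notin> D \<longrightarrow> R (g i) $ j = 0)"
  let ?P = "\<lambda>g D x. (\<forall>q. x $ q \<noteq> 0 \<longrightarrow> st q \<in> D) \<and>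
          (\<forall>r lam v. (\<forall>i. r $ g i + R (g i) \<bullet> v = lam + v $ i) \<longrightarrow> x \<bullet> r = lam)"
  have "\<exists>x. ?P g D x" if ok: "?ok g D" for g D
  proof -
    obtain p where p: "\<forall>i. p $ i \<ge> 0" "\<forall>i. i \<notin> D \<longrightarrow> p $ i = 0" "(\<Sum>i\<in>UNIV. p $ i) = 1"
      "(\<Sum>i\<in>UNIV. p $ i *\<^sub>R R (g i)) = p"
      using stationary_distribution_exists[of "\<lambda>i. R (g i)" D] ok nonneg sum1 by blast
    \<comment> \<open>The image under \<open>g\<close> of the stationary distribution
      \<open>p\<close>.\<close>
    define x where "x = (\<Sum>i\<in>UNIV. p $ i *\<^sub>R axis (g i) (1::real))"
    have "st q \<in> D" if "x $ q \<noteq> 0" for q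
    proof -
      obtain i where "p $ i * axis (g i) (1::real) $ q \<noteq> 0"
        using \<open>x $ q \<noteq> 0\<close> by (auto simp: x_def elim: sum.not_neutral_contains_not_neutral)
      then have "i \<in> D" "g i = q"
        using p(2) by (auto simp: axis_def split: if_splits)
      then show ?thesis using ok by auto
    qed
    moreover have "x \<bullet> r = lam" if rv: "\<forall>i. r $ g i + R (g i) \<bullet> v = lam + v $ i" for r lam v
    proof -
      \<comment> \<open>Averaging the equation for \<open>v\<close> under \<open>p\<close>, the bias
        terms cancel by stationarity.\<close>
      have "p \<bullet> v = (\<Sum>i\<in>UNIV. p $ i * (R (g i) \<bullet> v))"
        by (subst p(4)[symmetric]) (simp add: inner_sum_left)
      moreover have "x \<bullet> r = (\<Sum>i\<in>UNIV. p $ i * r $ g i)"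
        by (simp add: x_def inner_sum_left inner_axis')
      ultimately have "x \<bullet> r + p \<bullet> v = (\<Sum>i\<in>UNIV. p $ i * (lam + v $ i))"
        by (simp add: sum.distrib[symmetric] distrib_left[symmetric] rv)
      also have "\<dots> = lam + p \<bullet> v"
        using p(3) by (simp add: inner_vec_def distrib_left sum.distrib flip: sum_distrib_right)
      finally show ?thesis by simp
    qed
    ultimately show ?thesis by blast
  qed
  then obtain x where x: "\<And>g D. ?ok g D \<Longrightarrow> ?P g D (x g D)"
    by metis
  have "occupation_family st R (range (case_prod x))"
    unfolding occupation_family_def
  proof (intro allI impI)
    fix g D assume "?ok g D"
    from x[OF this] show "\<exists>y\<in>range (case_prod x). ?P g D y"
      by (intro bexI[of _ "x g D"] image_eqI[of _ _ "(g, D)"]) simp_all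
  qed
  then show ?thesis
    by (intro exI[of _ "range (case_prod x)"]) simp
qed

text \<open>
  The difference \<open>u - v\<close> is superharmonic for \<open>g\<close> when \<open>lam = mu\<close>, so the set where it is minimal
  is closed and carries an occupation measure.
\<close>

lemma supersolution_comparison:
  fixes R :: "'q::finite \<Rightarrow> real^'s::finite"
  assumes nonneg: "\<And>q j. R q $ j \<ge> 0" and sum1: "\<And>q. (\<Sum>j\<in>UNIV. R q $ j) = 1"
    and X: "occupation_family st R X"
    and g: "\<And>i. st (g i) = i"
    and v: "\<And>i. r $ g i + R (g i) \<bullet> v = lam + v $ i"
    and u: "\<And>i. r $ g i + R (g i) \<bullet> u \<le> mu + u $ i"
  shows "lam \<le> mu"
    and "lam = mu \<Longrightarrow>
      \<exists>x\<in>X. x \<noteq> 0 \<and> x \<bullet> r = lam \<and> (\<forall>q j. x $ q \<noteq> 0 \<longrightarrow> u $ st q - v $ st q \<le> u $ j - v $ j)"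
proof -
  define d where "d = u - v"
  define m where "m = Min (range (($) d))"
  have m: "m \<le> d $ j" for j
    by (simp add: m_def)
  have "m \<in> range (($) d)"
    unfolding m_def by (rule Min_in) auto
  then obtain i0 where i0: "d $ i0 = m"
    by auto
  have Rd: "R (g i) \<bullet> d \<le> d $ i + (mu - lam)" for i
    using u[of i] v[of i] by (simp add: d_def inner_diff_right)
  note R = superharmonic_argmin_closed[OF nonneg sum1 m]
  \<comment> \<open>At a minimiser, the average of \<open>d\<close> is at least \<open>m\<close> and
    at most \<open>m + (mu - lam)\<close>.\<close>
  show "lam \<le> mu"
    using Rd[of i0] R(1)[of "g i0"] i0 by simp
  assume "lam = mu"
  define D where "D = {i. d $ i = m}"
  have "\<forall>i\<in>D. \<forall>j. j \<notin> D \<longrightarrow> R (g i) $ j = 0"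
    using Rd R(2) \<open>lam = mu\<close> by (force simp: D_def)
  moreover have "D \<noteq> {}"
    using i0 by (auto simp: D_def)
  ultimately obtain x where "x \<in> X" and x: "\<And>q. x $ q \<noteq> 0 \<Longrightarrow> st q \<in> D"
    "\<And>r lam v. (\<forall>i. r $ g i + R (g i) \<bullet> v = lam + v $ i) \<Longrightarrow> x \<bullet> r = lam"
    using X g unfolding occupation_family_def by metis
  \<comment> \<open>Unit payments with zero bias have mean payoff 1, so \<open>x\<close> cannot
    vanish.\<close>
  have "x \<bullet> r = lam" "x \<bullet> 1 = 1"
    using x(2)[of r v lam] x(2)[of 1 0 1] v by simp_all
  then have "x \<noteq> 0" "x \<bullet> r = lam" by auto
  then show "\<exists>x\<in>X. x \<noteq> 0 \<and> x \<bullet> r = lam \<and> (\<forall>q j. x $ q \<noteq> 0 \<longrightarrow> u $ st q - v $ st q \<le> u $ j - v $ j)"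
    using m \<open>x \<in> X\<close> x(1) \<open>x \<noteq> 0\<close> \<open>x \<bullet> r = lam\<close> by (intro bexI[of _ x]) (auto simp: D_def d_def)
qed

subsection \<open>Policy iteration\<close>

text \<open>The new policy attains \<open>T v\<close>, which is at most the value of the old policy
  at \<open>v\<close>; so \<open>v\<close> is a supersolution for the new policy with the old
  eigenvalue.\<close>

lemma hoffman_karp_step_le:
  assumes "hoffman_karp_step \<Sigma> T Tp \<sigma> lam v \<sigma>'" "\<And>i. T v $ i \<le> Tp \<sigma> v $ i"
  shows "Tp \<sigma>' v $ i \<le> lam + v $ i"
proof -
  have "Tp \<sigma>' v $ i \<le> Tp \<sigma> v $ i"
    using assms by (metis hoffman_karp_step_def)
  also have "\<dots> = lam + v $ i"
    using assms(1) by (simp add: hoffman_karp_step_def eigenpair_def)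
  finally show ?thesis .
qed

text \<open>
  The state \<open>s lam\<close> belongs to the support of the occupation measure of mean payoff \<open>lam\<close>.
\<close>

lemma hoffman_karp_terminates:
  fixes Tp :: "'p \<Rightarrow> real^'s \<Rightarrow> real^'s::finite" and s :: "real \<Rightarrow> 's"
  assumes "finite \<Sigma>"
    and le: "\<And>\<tau> x i. \<tau> \<in> \<Sigma> \<Longrightarrow> T x $ i \<le> Tp \<tau> x $ i"
    and hom: "\<And>\<tau> x c. \<tau> \<in> \<Sigma> \<Longrightarrow> Tp \<tau> (x + c *\<^sub>R 1) = Tp \<tau> x + c *\<^sub>R 1"
    and le_eigenvalue: "\<And>\<tau> lam v mu u. \<lbrakk>\<tau> \<in> \<Sigma>; eigenpair (Tp \<tau>) lam v; \<And>i. Tp \<tau> u $ i \<le> mu + u $ i\<rbrakk>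
      \<Longrightarrow> lam \<le> mu"
    and le_bias: "\<And>\<tau> lam v u j. \<lbrakk>\<tau> \<in> \<Sigma>; eigenpair (Tp \<tau>) lam v; \<And>i. Tp \<tau> u $ i \<le> lam + u $ i\<rbrakk>
      \<Longrightarrow> u $ s lam - v $ s lam \<le> u $ j - v $ j"
    and exec: "hoffman_karp_execution \<Sigma> T Tp N \<sigma> lam v"
    and wp: "hoffman_karp_well_posed Tp N \<sigma>"
  shows "\<exists>k. hoffman_karp_stops N \<sigma> k \<and> eigenpair T (lam k) (v k)"
proof -
  have step: "hoffman_karp_step \<Sigma> T Tp (\<sigma> k) (lam k) (v k) (\<sigma> (Suc k))" if "enat k < N" for k
    using exec that by (simp add: hoffman_karp_execution_def)
  have "N \<noteq> \<infinity>"
  proof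
    assume "N = \<infinity>"
    then have step: "hoffman_karp_step \<Sigma> T Tp (\<sigma> k) (lam k) (v k) (\<sigma> (Suc k))"
      and neq: "\<sigma> (Suc k) \<noteq> \<sigma> k" for k
      using exec by (simp_all add: hoffman_karp_execution_def)
    have \<sigma>: "\<sigma> k \<in> \<Sigma>" for k
      using exec step by (cases k) (auto simp: hoffman_karp_execution_def hoffman_karp_step_def)
    have eig: "eigenpair (Tp (\<sigma> k)) (lam k) (v k)" for k
      using step by (simp add: hoffman_karp_step_def)
    have super: "Tp (\<sigma> (Suc k)) (v k) $ i \<le> lam k + v k $ i" for k i
      using hoffman_karp_step_le[OF step] le[OF \<sigma>] by blast
    have "lam (Suc k) \<le> lam k" for k
      using le_eigenvalue[OF \<sigma> eig super] .
    then have dec: "decseq lam"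
      by (rule decseq_SucI)
    have "\<not> inj \<sigma>"
      using \<sigma> \<open>finite \<Sigma>\<close> by (metis finite_imageD finite_subset image_subsetI infinite_UNIV_nat)
    then obtain k m where km: "k < m" "\<sigma> m = \<sigma> k"
      unfolding inj_on_def by (metis linorder_neqE_nat)
    \<comment> \<open>As \<open>\<sigma> m = \<sigma> k\<close>, the pair of step \<open>m\<close>
      is a supersolution for the policy of step \<open>k\<close>; comparison then bounds
      \<open>lam k\<close> by \<open>lam m\<close>.\<close>
    have m_le: "Tp (\<sigma> k) (v m) $ i \<le> lam m + v m $ i" for i
      using eig[of m] km by (simp add: eigenpair_def)
    have "lam k \<le> lam m"
      using le_eigenvalue[OF \<sigma> eig m_le] .
    then have lam: "lam j = lam k" if "k \<le> j" "j \<le> m" for j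
      using decseqD[OF dec that(1)] decseqD[OF dec that(2)] by simp
    \<comment> \<open>The eigenvalue is constant from \<open>k\<close> to \<open>m\<close>, so one
      state normalises all these bias vectors.\<close>
    define h where "h j l = v j $ l - v j $ s (lam k)" for j l
    have h_Suc: "h (Suc j) l \<le> h j l" if "k \<le> j" "j < m" for j l
      using le_bias[OF \<sigma> eig, of "Suc j" "v j" l] super[of j] lam[of j] lam[of "Suc j"] that
      by (simp add: h_def)
    have h_mono: "h m l \<le> h (Suc k) l" for l
    proof -
      have "Suc k \<le> m" using km by simp
      then show ?thesis
      proof (induction rule: inc_induct)
        case (step j)
        then show ?case using h_Suc[of j l] by simp
      qed simp
    qed
    \<comment> \<open>This closes the cycle \<open>h m \<le> h (Suc k) \<le> h k \<le> h m\<close>,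
      forcing equality throughout.\<close>
    have "h k l \<le> h m l" for l
      using le_bias[OF \<sigma> eig, of k "v m" l] m_le lam[of m] km by (simp add: h_def)
    then have h_eq: "h k l = h (Suc k) l" for l
      using h_mono[of l] h_Suc[of k l] km by (metis antisym order_trans order_refl)
    define c where "c = v k $ s (lam k) - v (Suc k) $ s (lam k)"
    have vk: "v k = v (Suc k) + c *\<^sub>R 1"
      using h_eq by (simp add: vec_eq_iff h_def c_def algebra_simps)
    have "lam (Suc k) = lam k"
      using lam[of "Suc k"] km by simp
    \<comment> \<open>By additive homogeneity \<open>v k\<close> is a bias vector for both policies;
      hence \<open>\<sigma> k\<close> attains \<open>T (v k)\<close> and the rule for ties keeps
      it.\<close>
    then have "Tp (\<sigma> (Suc k)) (v k) = lam k *\<^sub>R 1 + v k"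
      using eig[of "Suc k"] hom[OF \<sigma>, of "Suc k" "v (Suc k)" c] vk by (simp add: eigenpair_def)
    then have "T (v k) = Tp (\<sigma> k) (v k)"
      using step[of k] by (simp add: hoffman_karp_step_def eigenpair_def)
    then show False
      using step[of k] neq[of k] by (simp add: hoffman_karp_step_def)
  qed
  \<comment> \<open>Well-posedness leaves the stopping test as the only end of a finite execution;
    then \<open>\<sigma> k\<close> itself attains \<open>T (v k)\<close>.\<close>
  then obtain m where "N = enat m" by auto
  moreover have "has_eigenvalue (Tp (\<sigma> m))"
    using wp \<open>N = enat m\<close> by (simp add: hoffman_karp_well_posed_def)
  ultimately obtain k where k: "hoffman_karp_stops N \<sigma> k"
    using exec by (auto simp: hoffman_karp_execution_def)
  then have "hoffman_karp_step \<Sigma> T Tp (\<sigma> k) (lam k) (v k) (\<sigma> k)"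
    using step[of k] by (simp add: hoffman_karp_stops_def)
  then have "eigenpair T (lam k) (v k)"
    by (simp add: hoffman_karp_step_def eigenpair_def)
  then show ?thesis using k by blast
qed

section \<open>Order, homogeneity and best replies for the Shapley operators\<close>

lemma shapley_le_shapley_policy:
  assumes "\<And>i. finite (A i)" "\<tau> \<in> policies A"
  shows "shapley A B P e r x $ i \<le> shapley_policy B P e r \<tau> x $ i"
  using assms by (auto simp: shapley_def shapley_policy_def policies_def intro!: Min_le)

lemma shapley_policy_add_const:
  assumes "\<And>i. finite (B i (\<tau> i))" "\<And>i. B i (\<tau> i) \<noteq> {}"
    and sum1: "\<And>i b. b \<in> B i (\<tau> i) \<Longrightarrow> (\<Sum>j\<in>UNIV. P i (\<tau> i) b $ j) = 1"
  shows "shapley_policy B P e r \<tau> (x + c *\<^sub>R 1) = shapley_policy B P e r \<tau> x + c *\<^sub>R 1"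
proof -
  have "(MAX b\<in>B i (\<tau> i). payment e r i (\<tau> i) b + P i (\<tau> i) b \<bullet> (x + c *\<^sub>R 1)) =
      (MAX b\<in>B i (\<tau> i). payment e r i (\<tau> i) b + P i (\<tau> i) b \<bullet> x + c)" for i
  proof (intro arg_cong[where f = Max] image_cong refl)
    fix b assume "b \<in> B i (\<tau> i)"
    then have "P i (\<tau> i) b \<bullet> 1 = 1"
      using sum1 by (simp add: inner_vec_def)
    then show "payment e r i (\<tau> i) b + P i (\<tau> i) b \<bullet> (x + c *\<^sub>R 1) =
        payment e r i (\<tau> i) b + P i (\<tau> i) b \<bullet> x + c"
      by (simp add: inner_add_right)
  qed
  then show ?thesis
    using assms(1,2) by (simp add: shapley_policy_def vec_eq_iff Max_add_commute)
qed

lemma finite_policies: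
  fixes A :: "'s::finite \<Rightarrow> 'a set"
  assumes "\<And>i. finite (A i)"
  shows "finite (policies A)"
proof -
  have "policies A = PiE UNIV A"
    by (auto simp: policies_def)
  then show ?thesis
    using assms by (simp add: finite_PiE)
qed

text \<open>Fixing best replies of MAX at \<open>v\<close> gives a joint policy \<open>g\<close>
  whose affine operator touches the policy operator at \<open>v\<close> and stays below it. This
  reduces comparisons to one Markov chain.\<close>

lemma shapley_policy_greedy:
  fixes e :: "'q::finite \<Rightarrow> 's::finite \<times> 'a \<times> 'b" and P :: "'s \<Rightarrow> 'a \<Rightarrow> 'b \<Rightarrow> real^'s"
  defines "R \<equiv> \<lambda>q. case e q of (i, a, b) \<Rightarrow> P i a b"
  assumes e: "bij_betw e UNIV (triples A B)" and \<tau>: "\<tau> \<in> policies A"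
    and fin: "\<And>i. finite (B i (\<tau> i))" and ne: "\<And>i. B i (\<tau> i) \<noteq> {}"
  shows "\<exists>g. (\<forall>i. fst (e (g i)) = i) \<and>
    (\<forall>i. r $ g i + R (g i) \<bullet> v = shapley_policy B P e r \<tau> v $ i) \<and>
    (\<forall>u i. r $ g i + R (g i) \<bullet> u \<le> shapley_policy B P e r \<tau> u $ i)"
proof -
  let ?f = "\<lambda>i u b. payment e r i (\<tau> i) b + P i (\<tau> i) b \<bullet> u"
  have "\<exists>b\<in>B i (\<tau> i). ?f i v b = (MAX b\<in>B i (\<tau> i). ?f i v b)" for i
    using Max_in[of "?f i v ` B i (\<tau> i)"] fin ne by fastforce
  then obtain b where b: "\<And>i. b i \<in> B i (\<tau> i)"
    "\<And>i. ?f i v (b i) = (MAX b\<in>B i (\<tau> i). ?f i v b)"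
    by metis
  define g where "g i = inv e (i, \<tau> i, b i)" for i
  have "(i, \<tau> i, b i) \<in> range e" for i
    using e \<tau> b(1) by (auto simp: bij_betw_def triples_def policies_def)
  then have eg: "e (g i) = (i, \<tau> i, b i)" for i
    unfolding g_def by (rule f_inv_into_f)
  have f: "r $ g i + R (g i) \<bullet> u = ?f i u (b i)" for i u
    by (simp add: R_def eg payment_def) (simp add: g_def)
  show ?thesis
    using eg b fin by (intro exI[of _ g]) (auto simp: f shapley_policy_def intro!: Max_ge)
qed

theorem theorem22:
  fixes A :: "'s::finite \<Rightarrow> 'a set"
    and B :: "'s \<Rightarrow> 'a \<Rightarrow> 'b set"
    and P :: "'s \<Rightarrow> 'a \<Rightarrow> 'b \<Rightarrow> real^'s"
    and e :: "'q::finite \<Rightarrow> 's \<times> 'a \<times> 'b"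
  assumes "\<And>i. finite (A i)" and "\<And>i. A i \<noteq> {}"
    and "\<And>i a. a \<in> A i \<Longrightarrow> finite (B i a)" and "\<And>i a. a \<in> A i \<Longrightarrow> B i a \<noteq> {}"
    and "\<And>i a b j. a \<in> A i \<Longrightarrow> b \<in> B i a \<Longrightarrow> P i a b $ j \<ge> 0"
    and "\<And>i a b. a \<in> A i \<Longrightarrow> b \<in> B i a \<Longrightarrow> (\<Sum>j\<in>UNIV. P i a b $ j) = 1"
    and "bij_betw e UNIV (triples A B)"
  shows "\<exists>K :: (real^'q) set set.
    polyhedral_fan K \<and> \<Union>K = UNIV \<and>
    (\<forall>C\<in>K. aff_dim C = int DIM(real^'q) \<longrightarrow>
      (\<forall>r\<in>interior C. \<forall>N \<sigma> lam v.
        hoffman_karp_execution (policies A) (shapley A B P e r) (shapley_policy B P e r) N \<sigma> lam v \<and>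
        hoffman_karp_well_posed (shapley_policy B P e r) N \<sigma> \<longrightarrow>
        (\<exists>k. hoffman_karp_stops N \<sigma> k \<and> eigenpair (shapley A B P e r) (lam k) (v k))))"
proof -
  define R where "R = (\<lambda>q. case e q of (i, a, b) \<Rightarrow> P i a b)"
  define st where "st q = fst (e q)" for q
  have e: "e q \<in> triples A B" for q
    using assms(7) by (auto simp: bij_betw_def)
  then have R: "R q $ j \<ge> 0" "(\<Sum>j\<in>UNIV. R q $ j) = 1" for q j
  proof -
    obtain i a b where "e q = (i, a, b)" by (cases "e q")
    moreover have "a \<in> A i" "b \<in> B i a"
      using e[of q] calculation by (auto simp: triples_def)
    ultimately show "R q $ j \<ge> 0" "(\<Sum>j\<in>UNIV. R q $ j) = 1"
      using assms(5,6) by (simp_all add: R_def)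
  qed
  obtain X where X: "finite X" "occupation_family st R X"
    using finite_occupation_family_exists[of R st, OF R] by blast
  \<comment> \<open>Equal pairs contribute the zero vector, which imposes no condition on
    cells.\<close>
  define Z where "Z = (\<lambda>(x, y). x - y) ` (X \<times> X)"
  have "finite Z"
    using X by (simp add: Z_def)
  have stop: "\<exists>k. hoffman_karp_stops N \<sigma> k \<and> eigenpair (shapley A B P e r) (lam k) (v k)"
    if r: "r \<in> interior (arrangement_cell Z y)"
      and exec: "hoffman_karp_execution (policies A) (shapley A B P e r) (shapley_policy B P e r) N \<sigma> lam v"
      and wp: "hoffman_karp_well_posed (shapley_policy B P e r) N \<sigma>"
    for y r N \<sigma> lam v
  proof -
    have generic: "x = x'" if "x \<in> X" "x' \<in> X" "x \<bullet> r = x' \<bullet> r" for x x'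
    proof -
      have "(x - x') \<bullet> r = 0" "x - x' \<in> Z"
        using that by (auto simp: inner_diff_left Z_def)
      then show ?thesis
        using interior_arrangement_cell_nonzero[OF r, of "x - x'"] by auto
    qed
    \<comment> \<open>By genericity at most one nonzero measure earns \<open>l\<close>; any state of
      its support will do, and any state at all if there is none.\<close>
    have "\<exists>i. \<forall>x\<in>X. x \<noteq> 0 \<and> x \<bullet> r = l \<longrightarrow> (\<exists>q. x $ q \<noteq> 0 \<and> st q = i)" for l
    proof (cases "\<exists>x\<in>X. x \<noteq> 0 \<and> x \<bullet> r = l")
      case True
      then obtain x where x: "x \<in> X" "x \<noteq> 0" "x \<bullet> r = l" by blast
      then obtain q where "x $ q \<noteq> 0" by (auto simp: vec_eq_iff)
      then show ?thesis using generic x by metis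
    qed auto
    then obtain s where s: "\<And>l x. x \<in> X \<Longrightarrow> x \<noteq> 0 \<Longrightarrow> x \<bullet> r = l \<Longrightarrow> \<exists>q. x $ q \<noteq> 0 \<and> st q = s l"
      by metis
    have \<tau>: "finite (B i (\<tau> i))" "B i (\<tau> i) \<noteq> {}" if "\<tau> \<in> policies A" for \<tau> i
      using that assms(3,4) by (auto simp: policies_def)
    have greedy: "\<exists>g. (\<forall>i. st (g i) = i) \<and> (\<forall>i. r $ g i + R (g i) \<bullet> w = l + w $ i) \<and>
        (\<forall>i. r $ g i + R (g i) \<bullet> u \<le> mu + u $ i)"
      if pol: "\<tau> \<in> policies A" and w: "eigenpair (shapley_policy B P e r \<tau>) l w"
        and u: "\<And>i. shapley_policy B P e r \<tau> u $ i \<le> mu + u $ i" for \<tau> l w mu u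
    proof -
      obtain g where "\<forall>i. fst (e (g i)) = i"
        "\<forall>i. r $ g i + R (g i) \<bullet> w = shapley_policy B P e r \<tau> w $ i"
        "\<forall>u i. r $ g i + R (g i) \<bullet> u \<le> shapley_policy B P e r \<tau> u $ i"
        using shapley_policy_greedy[OF assms(7) pol \<tau>[OF pol], where r = r and v = w and P = P]
        unfolding R_def by blast
      then show ?thesis
        using w u by (intro exI[of _ g]) (auto simp: st_def eigenpair_def intro: order_trans[OF _ u])
    qed
    show ?thesis
    proof (rule hoffman_karp_terminates[OF _ _ _ _ _ exec wp, where s = s])
      show "finite (policies A)"
        using finite_policies assms(1) by blast
      show "shapley A B P e r x $ i \<le> shapley_policy B P e r \<tau> x $ i" if "\<tau> \<in> policies A" for \<tau> x i
        using shapley_le_shapley_policy assms(1) that by blast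
      show "shapley_policy B P e r \<tau> (x + c *\<^sub>R 1) = shapley_policy B P e r \<tau> x + c *\<^sub>R 1"
        if "\<tau> \<in> policies A" for \<tau> x c
        using \<tau>[OF that] that assms(6) by (intro shapley_policy_add_const) (auto simp: policies_def)
    next
      fix \<tau> l w mu u
      assume "\<tau> \<in> policies A" and "eigenpair (shapley_policy B P e r \<tau>) l w"
        and "\<And>i. shapley_policy B P e r \<tau> u $ i \<le> mu + u $ i"
      then obtain g where "\<And>i. st (g i) = i" "\<And>i. r $ g i + R (g i) \<bullet> w = l + w $ i"
        "\<And>i. r $ g i + R (g i) \<bullet> u \<le> mu + u $ i"
        using greedy by metis
      then show "l \<le> mu"
        by (rule supersolution_comparison(1)[of R, OF R X(2)])
    next
      fix \<tau> l w u j
      assume "\<tau> \<in> policies A" and "eigenpair (shapley_policy B P e r \<tau>) l w"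
        and "\<And>i. shapley_policy B P e r \<tau> u $ i \<le> l + u $ i"
      then obtain g where "\<And>i. st (g i) = i" "\<And>i. r $ g i + R (g i) \<bullet> w = l + w $ i"
        "\<And>i. r $ g i + R (g i) \<bullet> u \<le> l + u $ i"
        using greedy by metis
      \<comment> \<open>The minimisers of \<open>u - w\<close> contain the support of a measure
        earning \<open>l\<close>, hence the state \<open>s l\<close>.\<close>
      then have "\<exists>x\<in>X. x \<noteq> 0 \<and> x \<bullet> r = l \<and>
          (\<forall>q j. x $ q \<noteq> 0 \<longrightarrow> u $ st q - w $ st q \<le> u $ j - w $ j)"
        by (rule supersolution_comparison(2)[of R, OF R X(2) _ _ _ refl])
      then show "u $ s l - w $ s l \<le> u $ j - w $ j"
        using s by metis
    qed
  qed
  show ?thesis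
  proof (intro exI[of _ "range (arrangement_cell Z)"] conjI)
    show "polyhedral_fan (range (arrangement_cell Z))"
      by (rule polyhedral_fan_arrangement[OF \<open>finite Z\<close>])
    show "\<Union>(range (arrangement_cell Z)) = UNIV"
      using mem_arrangement_cell by blast
  qed (use stop in blast)
qed

end
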